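(* For every finite set $\Gamma$ of labeled hypotheses, mode $r$, and ordered context $\Omega$ with $\Omega\geq r$ and all hypotheses of $\Omega$ in $\Gamma$, the construction of the set $\mathsf{NF}_{\Gamma,r}(\Omega)=\{\Omega'\mid\Omega\leadsto^{\Gamma}_{r}\Omega'\}$ by exhaustive application of the rules of $\leadsto$ terminates; in particular this set is finite.
   Context: Fix a preorder $(\mathcal{M},\geq)$ of modes and, for each mode $m$, a set $\sigma(m)\subseteq\{\mathsf{W},\mathsf{C}^\leftarrow,\mathsf{C}^\rightarrow,\mathsf{M}^\leftarrow,\mathsf{M}^\rightarrow\}$ (weakening, left/right contraction, left/right mobility), monotone: $k\geq m$ implies $\sigma(k)\supseteq\sigma(m)$, and satisfying: if $\mathsf{W},\mathsf{C}^\leftarrow\in\sigma(m)$ then $\mathsf{M}^\leftarrow\in\sigma(m)$; if $\mathsf{W},\mathsf{C}^\rightarrow\in\sigma(m)$ then $\mathsf{M}^\rightarrow\in\sigma(m)$. Propositions $A_m$ are indexed by modes. An ordered context $\Omega$ is a finite sequence of labeled hypotheses $x{:}A_m$ (repetitions allowed, each variable always labeling the same proposition); $|\Omega|$ is its set of variables; $\Omega\geq r$ means every $y{:}B_k$ in $\Omega$ has $k\geq r$; $\Omega$ is normal ($\Omega\ \mathsf{nf}$) if no variable occurs twice. The relation $\Omega\leadsto^{\Gamma}_{r}\Omega'$ ($\Omega$, $\Gamma$, $r$ inputs, $\Omega'$ output) is generated by the rules (premise $\Rightarrow$ conclusion): (W) $\Omega_L(x{:}A_m)\Omega_R\leadsto\Omega'$,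 $\mathsf{W}\in\sigma(m)$, $m\geq r$, $x{:}A_m\in\Gamma$, $x\notin|\Omega_L\Omega_R|\Rightarrow\Omega_L\Omega_R\leadsto\Omega'$; ($\mathsf{C}^\leftarrow$) $\Omega_L(x{:}A_m)\Omega_M\Omega_R\leadsto\Omega'$, $\mathsf{C}^\leftarrow\in\sigma(m)\Rightarrow\Omega_L(x{:}A_m)\Omega_M(x{:}A_m)\Omega_R\leadsto\Omega'$; ($\mathsf{C}^\rightarrow$) $\Omega_L\Omega_M(x{:}A_m)\Omega_R\leadsto\Omega'$, $\mathsf{C}^\rightarrow\in\sigma(m)\Rightarrow\Omega_L(x{:}A_m)\Omega_M(x{:}A_m)\Omega_R\leadsto\Omega'$; ($\mathsf{M}^\leftarrow$) $\Omega_L(x{:}A_m)\Omega_M\Omega_R\leadsto\Omega'$, $\mathsf{M}^\leftarrow\in\sigma(m)\Rightarrow\Omega_L\Omega_M(x{:}A_m)\Omega_R\leadsto\Omega'$; ($\mathsf{M}^\rightarrow$) $\Omega_L\Omega_M(x{:}A_m)\Omega_R\leadsto\Omega'$, $\mathsf{M}^\rightarrow\in\sigma(m)\Rightarrow\Omega_L(x{:}A_m)\Omega_M\Omega_R\leadsto\Omega'$; (id) $\Omega\ \mathsf{nf}\Rightarrow\Omega\leadsto\Omega$. (All arrows carry the same $\Gamma$ and $r$.) *)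

theory Defs
  imports Main
begin

text \<open>
  Propositions form a type \<open>'p\<close>, and a function \<open>mode :: 'p \<Rightarrow> 'm\<close> gives the mode at which
  a proposition lives; thus \<open>(x, A)\<close> with \<open>mode A = m\<close> stands for the labeled hypothesis
  \<open>x : A\<^sub>m\<close>. The preorder of modes is the one of the type class.
\<close>

datatype structural = W | CLeft | CRight | MLeft | MRight

definition mode_structure :: "('m::preorder \<Rightarrow> structural set) \<Rightarrow> bool" where
  "mode_structure \<sigma> \<longleftrightarrow>
     (\<forall>k m. k \<ge> m \<longrightarrow> \<sigma> k \<supseteq> \<sigma> m) \<and>
     (\<forall>m. W \<in> \<sigma> m \<and> CLeft \<in> \<sigma> m \<longrightarrow> MLeft \<in> \<sigma> m) \<and>
     (\<forall>m. W \<in> \<sigma> m \<and> CRight \<in> \<sigma> m \<longrightarrow> MRight \<in> \<sigma> m)"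

type_synonym ('v, 'p) hyp = "'v \<times> 'p"

definition ordered_context :: "('v, 'p) hyp list \<Rightarrow> bool" where
  "ordered_context \<Omega> \<longleftrightarrow> (\<forall>x A B. (x, A) \<in> set \<Omega> \<and> (x, B) \<in> set \<Omega> \<longrightarrow> A = B)"

definition vars :: "('v, 'p) hyp list \<Rightarrow> 'v set" where
  "vars \<Omega> = fst ` set \<Omega>"

definition context_ge :: "('p \<Rightarrow> 'm::preorder) \<Rightarrow> ('v, 'p) hyp list \<Rightarrow> 'm \<Rightarrow> bool" where
  "context_ge mode \<Omega> r \<longleftrightarrow> (\<forall>(y, B) \<in> set \<Omega>. mode B \<ge> r)"

definition normal :: "('v, 'p) hyp list \<Rightarrow> bool" where
  "normal \<Omega> \<longleftrightarrow> distinct (map fst \<Omega>)"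

text \<open>
  The rules are stated on arbitrary lists; read from conclusion to premise they preserve
  \<^const>\<open>ordered_context\<close> (lemma \<open>backward_ordered_context\<close> below), so nothing outside the
  ordered contexts is ever reached from one.
\<close>

inductive normalizes ::
  "('m::preorder \<Rightarrow> structural set) \<Rightarrow> ('p \<Rightarrow> 'm) \<Rightarrow> ('v, 'p) hyp set \<Rightarrow> 'm \<Rightarrow>
   ('v, 'p) hyp list \<Rightarrow> ('v, 'p) hyp list \<Rightarrow> bool"
  for \<sigma> mode \<Gamma> r where
  W: "normalizes \<sigma> mode \<Gamma> r (\<Omega>L @ [(x, A)] @ \<Omega>R) \<Omega>' \<Longrightarrow> W \<in> \<sigma> (mode A) \<Longrightarrow> mode A \<ge> r \<Longrightarrow>
      (x, A) \<in> \<Gamma> \<Longrightarrow> x \<notin> vars (\<Omega>L @ \<Omega>R) \<Longrightarrow>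
      normalizes \<sigma> mode \<Gamma> r (\<Omega>L @ \<Omega>R) \<Omega>'"
| CLeft: "normalizes \<sigma> mode \<Gamma> r (\<Omega>L @ [(x, A)] @ \<Omega>M @ \<Omega>R) \<Omega>' \<Longrightarrow> CLeft \<in> \<sigma> (mode A) \<Longrightarrow>
      normalizes \<sigma> mode \<Gamma> r (\<Omega>L @ [(x, A)] @ \<Omega>M @ [(x, A)] @ \<Omega>R) \<Omega>'"
| CRight: "normalizes \<sigma> mode \<Gamma> r (\<Omega>L @ \<Omega>M @ [(x, A)] @ \<Omega>R) \<Omega>' \<Longrightarrow> CRight \<in> \<sigma> (mode A) \<Longrightarrow>
      normalizes \<sigma> mode \<Gamma> r (\<Omega>L @ [(x, A)] @ \<Omega>M @ [(x, A)] @ \<Omega>R) \<Omega>'"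
| MLeft: "normalizes \<sigma> mode \<Gamma> r (\<Omega>L @ [(x, A)] @ \<Omega>M @ \<Omega>R) \<Omega>' \<Longrightarrow> MLeft \<in> \<sigma> (mode A) \<Longrightarrow>
      normalizes \<sigma> mode \<Gamma> r (\<Omega>L @ \<Omega>M @ [(x, A)] @ \<Omega>R) \<Omega>'"
| MRight: "normalizes \<sigma> mode \<Gamma> r (\<Omega>L @ \<Omega>M @ [(x, A)] @ \<Omega>R) \<Omega>' \<Longrightarrow> MRight \<in> \<sigma> (mode A) \<Longrightarrow>
      normalizes \<sigma> mode \<Gamma> r (\<Omega>L @ [(x, A)] @ \<Omega>M @ \<Omega>R) \<Omega>'"
| id: "normal \<Omega> \<Longrightarrow> normalizes \<sigma> mode \<Gamma> r \<Omega> \<Omega>"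

definition NF ::
  "('m::preorder \<Rightarrow> structural set) \<Rightarrow> ('p \<Rightarrow> 'm) \<Rightarrow> ('v, 'p) hyp set \<Rightarrow> 'm \<Rightarrow>
   ('v, 'p) hyp list \<Rightarrow> ('v, 'p) hyp list set" where
  "NF \<sigma> mode \<Gamma> r \<Omega> = {\<Omega>'. normalizes \<sigma> mode \<Gamma> r \<Omega> \<Omega>'}"

text \<open>
  \<open>backward \<sigma> mode \<Gamma> r \<Omega> \<Omega>1\<close>: some rule other than \<open>id\<close>, with input \<open>\<Omega>\<close> in its conclusion,
  has input \<open>\<Omega>1\<close> in its premise.
\<close>

inductive backward ::
  "('m::preorder \<Rightarrow> structural set) \<Rightarrow> ('p \<Rightarrow> 'm) \<Rightarrow> ('v, 'p) hyp set \<Rightarrow> 'm \<Rightarrow>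
   ('v, 'p) hyp list \<Rightarrow> ('v, 'p) hyp list \<Rightarrow> bool"
  for \<sigma> mode \<Gamma> r where
  W: "W \<in> \<sigma> (mode A) \<Longrightarrow> mode A \<ge> r \<Longrightarrow> (x, A) \<in> \<Gamma> \<Longrightarrow> x \<notin> vars (\<Omega>L @ \<Omega>R) \<Longrightarrow>
      backward \<sigma> mode \<Gamma> r (\<Omega>L @ \<Omega>R) (\<Omega>L @ [(x, A)] @ \<Omega>R)"
| CLeft: "CLeft \<in> \<sigma> (mode A) \<Longrightarrow>
      backward \<sigma> mode \<Gamma> r (\<Omega>L @ [(x, A)] @ \<Omega>M @ [(x, A)] @ \<Omega>R) (\<Omega>L @ [(x, A)] @ \<Omega>M @ \<Omega>R)"
| CRight: "CRight \<in> \<sigma> (mode A) \<Longrightarrow>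
      backward \<sigma> mode \<Gamma> r (\<Omega>L @ [(x, A)] @ \<Omega>M @ [(x, A)] @ \<Omega>R) (\<Omega>L @ \<Omega>M @ [(x, A)] @ \<Omega>R)"
| MLeft: "MLeft \<in> \<sigma> (mode A) \<Longrightarrow>
      backward \<sigma> mode \<Gamma> r (\<Omega>L @ \<Omega>M @ [(x, A)] @ \<Omega>R) (\<Omega>L @ [(x, A)] @ \<Omega>M @ \<Omega>R)"
| MRight: "MRight \<in> \<sigma> (mode A) \<Longrightarrow>
      backward \<sigma> mode \<Gamma> r (\<Omega>L @ [(x, A)] @ \<Omega>M @ \<Omega>R) (\<Omega>L @ \<Omega>M @ [(x, A)] @ \<Omega>R)"

lemma backward_ordered_context:
  "backward \<sigma> mode \<Gamma> r \<Omega> \<Omega>1 \<Longrightarrow> ordered_context \<Omega> \<Longrightarrow> ordered_context \<Omega>1"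
  by (induction rule: backward.induct) (force simp: ordered_context_def vars_def)+

lemma normalizes_iff_backward:
  "normalizes \<sigma> mode \<Gamma> r \<Omega> \<Omega>' \<longleftrightarrow> (backward \<sigma> mode \<Gamma> r)\<^sup>*\<^sup>* \<Omega> \<Omega>' \<and> normal \<Omega>'"
proof
  assume "normalizes \<sigma> mode \<Gamma> r \<Omega> \<Omega>'"
  then show "(backward \<sigma> mode \<Gamma> r)\<^sup>*\<^sup>* \<Omega> \<Omega>' \<and> normal \<Omega>'"
    by (induction rule: normalizes.induct)
      (blast intro: backward.intros converse_rtranclp_into_rtranclp)+
next
  assume "(backward \<sigma> mode \<Gamma> r)\<^sup>*\<^sup>* \<Omega> \<Omega>' \<and> normal \<Omega>'"
  then have "(backward \<sigma> mode \<Gamma> r)\<^sup>*\<^sup>* \<Omega> \<Omega>'" and "normal \<Omega>'" by auto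
  then show "normalizes \<sigma> mode \<Gamma> r \<Omega> \<Omega>'"
  proof (induction rule: converse_rtranclp_induct)
    case base
    then show ?case by (rule normalizes.id)
  next
    case (step \<Omega> \<Omega>1)
    from step.hyps(1) step.IH[OF step.prems] show ?case
      by (induction rule: backward.induct) (blast intro: normalizes.intros)+
  qed
qed

text \<open>
  Exhaustive application of the rules. A state \<open>(S, N)\<close> consists of the set \<open>S\<close> of the inputs
  met so far and the set \<open>N\<close> of the outputs collected so far. A step applies one rule to some
  input in \<open>S\<close>, in any order, provided that this contributes something new. The proviso is
  needed: the mobility rules can undo each other, and with an empty \<open>\<Omega>M\<close> their premise equals
  their conclusion, so \<^const>\<open>backward\<close> itself has infinite chains.
\<close>

inductive construct ::
  "('m::preorder \<Rightarrow> structural set) \<Rightarrow> ('p \<Rightarrow> 'm) \<Rightarrow> ('v, 'p) hyp set \<Rightarrow> 'm \<Rightarrow>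
   ('v, 'p) hyp list set \<times> ('v, 'p) hyp list set \<Rightarrow>
   ('v, 'p) hyp list set \<times> ('v, 'p) hyp list set \<Rightarrow> bool"
  for \<sigma> mode \<Gamma> r where
  premise: "\<Omega> \<in> S \<Longrightarrow> backward \<sigma> mode \<Gamma> r \<Omega> \<Omega>1 \<Longrightarrow> \<Omega>1 \<notin> S \<Longrightarrow>
      construct \<sigma> mode \<Gamma> r (S, N) (insert \<Omega>1 S, N)"
| id: "\<Omega> \<in> S \<Longrightarrow> normal \<Omega> \<Longrightarrow> \<Omega> \<notin> N \<Longrightarrow>
      construct \<sigma> mode \<Gamma> r (S, N) (S, insert \<Omega> N)"

text \<open>Every sequence of \<open>step\<close>s from \<open>s\<close> is finite.\<close>

definition terminates_from :: "('s \<Rightarrow> 's \<Rightarrow> bool) \<Rightarrow> 's \<Rightarrow> bool" where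
  "terminates_from step s \<longleftrightarrow> Wellfounded.accp step\<inverse>\<inverse> s"

end

(*
  Read from conclusion to premise, every rule keeps the hypotheses inside \<Gamma>, and none increases
  the length of the context plus the number of variables of \<Gamma> absent from it: weakening pays for
  the added hypothesis with a variable that was absent, and contraction never removes the last
  occurrence of a variable. So only finitely many contexts are reachable, and each step of the
  construction adds one of them to one of two growing sets.
*)

theory Submission
  imports Defs
begin

lemma backward_set_subset:
  "backward \<sigma> mode \<Gamma> r \<Omega> \<Omega>1 \<Longrightarrow> set \<Omega> \<subseteq> \<Gamma> \<Longrightarrow> set \<Omega>1 \<subseteq> \<Gamma>"
  by (induction rule: backward.induct) auto

text \<open>This serves to bound lengths and is not a termination measure: over a finite \<Gamma>,
  weakening and mobility leave it unchanged.\<close>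

definition weight :: "('v, 'p) hyp set \<Rightarrow> ('v, 'p) hyp list \<Rightarrow> nat" where
  "weight \<Gamma> \<Omega> = length \<Omega> + card (fst ` \<Gamma> - vars \<Omega>)"

lemma backward_weight_le:
  assumes "backward \<sigma> mode \<Gamma> r \<Omega> \<Omega>1" "finite \<Gamma>"
  shows "weight \<Gamma> \<Omega>1 \<le> weight \<Gamma> \<Omega>"
  using assms(1)
proof cases
  case (W A x \<Omega>L \<Omega>R)
  then have "vars \<Omega>1 = insert x (vars \<Omega>)" by (auto simp: vars_def)
  \<comment> \<open>The side conditions of weakening put \<open>x\<close> among the variables of
    \<Gamma> and outside \<open>vars \<Omega>\<close>, so exactly one absent variable is used
    up.\<close>
  then have "fst ` \<Gamma> - vars \<Omega> = insert x (fst ` \<Gamma> - vars \<Omega>1)" "x \<notin> fst ` \<Gamma> - vars \<Omega>1"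
    using W by force+
  then have "card (fst ` \<Gamma> - vars \<Omega>) = Suc (card (fst ` \<Gamma> - vars \<Omega>1))"
    using \<open>finite \<Gamma>\<close> by simp
  then show ?thesis using W by (simp add: weight_def)
\<comment> \<open>Contraction leaves a copy of its variable behind and mobility only permutes, so
  \<open>vars\<close> is unchanged and only the length matters.\<close>
qed (auto simp: weight_def vars_def insert_commute)

lemma finite_backward_reachable:
  assumes "finite \<Gamma>" "set \<Omega> \<subseteq> \<Gamma>"
  shows "finite {\<Omega>1. (backward \<sigma> mode \<Gamma> r)\<^sup>*\<^sup>* \<Omega> \<Omega>1}"
proof (rule finite_subset)
  have "set \<Omega>1 \<subseteq> \<Gamma> \<and> weight \<Gamma> \<Omega>1 \<le> weight \<Gamma> \<Omega>"
    if "(backward \<sigma> mode \<Gamma> r)\<^sup>*\<^sup>* \<Omega> \<Omega>1" for \<Omega>1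
    using that
  proof induction
    case base
    then show ?case using assms by simp
  next
    case (step \<Omega>1 \<Omega>2)
    then show ?case
      using backward_set_subset backward_weight_le[OF _ assms(1)] order_trans by metis
  qed
  \<comment> \<open>Dropping the cardinality summand of \<open>weight \<Gamma> \<Omega>1\<close>
    leaves a bound on the length.\<close>
  then show "{\<Omega>1. (backward \<sigma> mode \<Gamma> r)\<^sup>*\<^sup>* \<Omega> \<Omega>1} \<subseteq> {xs. set xs \<subseteq> \<Gamma> \<and> length xs \<le> weight \<Gamma> \<Omega>}"
    by (auto simp: weight_def dest: add_leD1)
  show "finite {xs. set xs \<subseteq> \<Gamma> \<and> length xs \<le> weight \<Gamma> \<Omega>}"
    by (rule finite_lists_length_le[OF assms(1)])
qed

text \<open>The freshness provisos of \<open>construct\<close> make each step remove an element from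
  \<open>R - S\<close> or from \<open>R - N\<close>; closure of the finite set \<open>R\<close>
  keeps both growing sets inside it.\<close>

lemma terminates_from_construct:
  assumes "finite R" and "S \<subseteq> R" "N \<subseteq> R"
    and closed: "\<And>\<Omega> \<Omega>1. \<Omega> \<in> R \<Longrightarrow> backward \<sigma> mode \<Gamma> r \<Omega> \<Omega>1 \<Longrightarrow> \<Omega>1 \<in> R"
  shows "terminates_from (construct \<sigma> mode \<Gamma> r) (S, N)"
  unfolding terminates_from_def using assms(2,3)
proof (induction "card (R - S) + card (R - N)" arbitrary: S N rule: less_induct)
  case less
  have grow: "card (R - insert a X) < card (R - X)" if "a \<in> R" "a \<notin> X" for a X
    using that \<open>finite R\<close> by (intro psubset_card_mono) auto
  show ?case
  proof (rule accp.accI)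
    fix s
    assume "(construct \<sigma> mode \<Gamma> r)\<inverse>\<inverse> s (S, N)"
    then have "construct \<sigma> mode \<Gamma> r (S, N) s" by simp
    then show "Wellfounded.accp (construct \<sigma> mode \<Gamma> r)\<inverse>\<inverse> s"
    proof cases
      case (premise \<Omega> \<Omega>1)
      then have "\<Omega>1 \<in> R" using closed less.prems by blast
      then show ?thesis using premise less grow[of \<Omega>1 S] by simp
    next
      case (id \<Omega>)
      then have "\<Omega> \<in> R" using less.prems by blast
      then show ?thesis using id less grow[of \<Omega> N] by simp
    qed
  qed
qed

text \<open>Invariants of every run: outputs are normal members of \<open>S\<close>, hence reachable
  normal contexts. The conjunct \<open>\<Omega> \<in> S\<close> is what
  \<open>construct_complete\<close> asks for.\<close>

lemma construct_sound:
  assumes "(construct \<sigma> mode \<Gamma> r)\<^sup>*\<^sup>* ({\<Omega>}, {}) (S, N)"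
  shows "\<Omega> \<in> S \<and> S \<subseteq> {\<Omega>1. (backward \<sigma> mode \<Gamma> r)\<^sup>*\<^sup>* \<Omega> \<Omega>1} \<and> N \<subseteq> NF \<sigma> mode \<Gamma> r \<Omega>"
  using assms
proof (induction rule: rtranclp_induct2)
  case refl
  then show ?case by simp
next
  case (step S N S1 N1)
  from step.hyps(2) step.IH show ?case
    by cases (auto simp: NF_def normalizes_iff_backward intro: rtranclp.rtrancl_into_rtrancl)
qed

text \<open>In a stuck state the rule \<open>premise\<close> adds nothing, so \<open>S\<close> is
  closed under \<open>backward\<close>, and the rule \<open>id\<close> adds nothing, so
  \<open>N\<close> contains every normal member of \<open>S\<close>.\<close>

lemma construct_complete:
  assumes "\<nexists>s. construct \<sigma> mode \<Gamma> r (S, N) s" "\<Omega> \<in> S"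
  shows "NF \<sigma> mode \<Gamma> r \<Omega> \<subseteq> N"
proof
  fix \<Omega>'
  assume "\<Omega>' \<in> NF \<sigma> mode \<Gamma> r \<Omega>"
  then have "(backward \<sigma> mode \<Gamma> r)\<^sup>*\<^sup>* \<Omega> \<Omega>'" "normal \<Omega>'"
    by (auto simp: NF_def normalizes_iff_backward)
  from this(1) have "\<Omega>' \<in> S"
    by induction (use assms construct.premise in blast)+
  then show "\<Omega>' \<in> N" using \<open>normal \<Omega>'\<close> assms(1) construct.id by blast
qed

theorem theorem7:
  fixes \<sigma> :: "'m::preorder \<Rightarrow> structural set"
    and mode :: "'p \<Rightarrow> 'm"
    and \<Gamma> :: "('v, 'p) hyp set"
    and r :: 'm
    and \<Omega> :: "('v, 'p) hyp list"
  assumes "mode_structure \<sigma>"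
    and "finite \<Gamma>"
    and "ordered_context \<Omega>"
    and "context_ge mode \<Omega> r"
    and "set \<Omega> \<subseteq> \<Gamma>"
  shows "terminates_from (construct \<sigma> mode \<Gamma> r) ({\<Omega>}, {}) \<and>
    (\<forall>S N. (construct \<sigma> mode \<Gamma> r)\<^sup>*\<^sup>* ({\<Omega>}, {}) (S, N) \<and>
           (\<nexists>s. construct \<sigma> mode \<Gamma> r (S, N) s) \<longrightarrow> N = NF \<sigma> mode \<Gamma> r \<Omega>) \<and>
    finite (NF \<sigma> mode \<Gamma> r \<Omega>)"
proof (intro conjI allI impI)
  \<comment> \<open>The reachable contexts are closed under \<open>backward\<close> and contain
    every normal form, so one finite set settles both termination and finiteness.\<close>
  let ?R = "{\<Omega>1. (backward \<sigma> mode \<Gamma> r)\<^sup>*\<^sup>* \<Omega> \<Omega>1}"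
  have fin: "finite ?R" by (rule finite_backward_reachable[OF assms(2,5)])
  show "terminates_from (construct \<sigma> mode \<Gamma> r) ({\<Omega>}, {})"
    by (rule terminates_from_construct[OF fin]) (auto intro: rtranclp.rtrancl_into_rtrancl)
  show "finite (NF \<sigma> mode \<Gamma> r \<Omega>)"
    by (rule finite_subset[OF _ fin]) (auto simp: NF_def normalizes_iff_backward)
next
  fix S N
  assume "(construct \<sigma> mode \<Gamma> r)\<^sup>*\<^sup>* ({\<Omega>}, {}) (S, N) \<and> (\<nexists>s. construct \<sigma> mode \<Gamma> r (S, N) s)"
  then show "N = NF \<sigma> mode \<Gamma> r \<Omega>"
    using construct_sound construct_complete by (metis subset_antisym)
qed

end
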